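(* Fix $k\in\mathbb{P}=\{1,2,3,\dots\}$. Define polynomials $G_n(x)=G_n^{(k)}(x)$ by $G_0(x)=-1$, $G_1(x)=x-1$, and $G_n(x)=x^kG_{n-1}(x)+G_{n-2}(x)$ for $n\ge 2$. For each $n\ge 1$ let $g_n=g_n^{(k)}$ denote the largest real root of $G_n(x)$. Let $\xi=\xi^{(k)}$ be the unique positive real root of $H^{(k)}(x)=x^k-x^{k-1}+x-2$. Then $g_n^{(k)}\to\xi^{(k)}$ as $n\to\infty$, the convergence being from above along even $n$ or from below along odd $n$ (i.e. depending on the parity of $n$). Moreover $\xi^{(k)}\to 1$ as $k\to\infty$.
   Context: $\mathbb{P}$ denotes the set of positive integers. For $n\ge1$, $G_n^{(k)}$ has positive leading coefficient and $G_n^{(k)}(0)=-1$, so the largest real root $g_n^{(k)}$ exists. The polynomial $H^{(k)}$ has exactly one positive real root, and it is greater than $1$. *)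

theory Defs
  imports "HOL-Computational_Algebra.Polynomial"
begin

fun G :: "nat \<Rightarrow> nat \<Rightarrow> real poly" where
  "G k 0 = [:-1:]"
| "G k (Suc 0) = [:-1, 1:]"
| "G k (Suc (Suc n)) = monom 1 k * G k (Suc n) + G k n"

(* The set of roots is finite and nonempty for n \<ge> 1; the value at n = 0 is meaningless. *)
definition g :: "nat \<Rightarrow> nat \<Rightarrow> real" where
  "g k n = Max {x. poly (G k n) x = 0}"

(* Intended for k \<ge> 1 only, because of the truncated subtraction in the exponent. *)
definition H :: "nat \<Rightarrow> real poly" where
  "H k = monom 1 k - monom 1 (k - 1) + [:-2, 1:]"

definition xi :: "nat \<Rightarrow> real" where
  "xi k = (THE x. x > 0 \<and> poly (H k) x = 0)"

end

(* At a fixed x the recurrence has characteristic roots lam > 0 and -u, where lam * u = 1 and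
   lam - u = x^k, and solving it gives
     (lam + u) G_n(x) = (x - 1 - u) lam^n - (-u)^n (lam + x - 1).
   For x > 1 the coefficient x - 1 - u has the sign of H(x), because
     x H(x) = (x - 1 - u) (x^k + x - 1 + u).
   At x = xi only the term in (-u)^n survives, which gives the parity statement; away from xi the
   term in lam^n dominates, with a bound uniform on the half-line to the right, which gives
   convergence. *)
theory Submission imports Defs begin

section \<open>The characteristic root of the recurrence\<close>

text \<open>The larger root of \<open>X^2 - t X - 1\<close>; by \<open>lam_minus_inverse\<close> the
  other one is \<open>- inverse (lam t)\<close>.\<close>

definition lam :: "real \<Rightarrow> real" where
  "lam t = (t + sqrt (t\<^sup>2 + 4)) / 2"

lemma lam_minus_inverse:
  assumes "t \<ge> 0"
  shows "lam t - inverse (lam t) = t"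
proof -
  have s: "(sqrt (t\<^sup>2 + 4))\<^sup>2 = t\<^sup>2 + 4"
    by simp
  have pos: "lam t > 0"
    unfolding lam_def using assms by (simp add: add_nonneg_pos add_pos_nonneg)
  have "lam t * lam t = t * lam t + 1"
    using s unfolding lam_def by (simp add: field_simps power2_eq_square)
  then show ?thesis
    using pos by (simp add: field_simps)
qed

lemma lam_ge:
  assumes "t \<ge> 0"
  shows "lam t \<ge> 1 + t / 2"
proof -
  have "sqrt (t\<^sup>2 + 4) \<ge> 2"
    by (rule real_le_rsqrt) simp
  then show ?thesis
    unfolding lam_def by simp
qed

lemma lam_gt_1: "t > 0 \<Longrightarrow> lam t > 1"
  using lam_ge[of t] by linarith

lemma lam_ge_self:
  assumes "t \<ge> 0"
  shows "t \<le> lam t"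
proof -
  have "lam t > 0"
    using lam_ge[OF assms] assms by linarith
  then have "inverse (lam t) > 0"
    by simp
  then show ?thesis
    using lam_minus_inverse[OF assms] by linarith
qed

lemma lam_mono:
  assumes "0 \<le> s" "s \<le> t"
  shows "lam s \<le> lam t"
proof -
  have "s\<^sup>2 \<le> t\<^sup>2"
    using assms by (simp add: power_mono)
  then show ?thesis
    unfolding lam_def using assms by (intro divide_right_mono add_mono real_sqrt_le_mono) auto
qed

section \<open>Closed form and sign of \<open>G\<close>\<close>

lemma poly_G_Suc_Suc:
  "poly (G k (Suc (Suc n))) x = x ^ k * poly (G k (Suc n)) x + poly (G k n) x"
  by (simp add: poly_monom)

text \<open>The hypotheses make \<open>l\<close> and \<open>- u\<close> the roots of
  \<open>X^2 - x^k X - 1\<close>, so both sides satisfy the recurrence of \<open>G\<close>. Keeping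
  \<open>l\<close> and \<open>u\<close> abstract keeps square roots out of the induction.\<close>

lemma poly_G_closed_form_aux:
  assumes "l * u = 1" "l - u = x ^ k"
  shows "(l + u) * poly (G k n) x = (x - 1 - u) * l ^ n - (- u) ^ n * (l + x - 1)"
proof (induction n rule: less_induct)
  case (less n)
  consider "n = 0" | "n = 1" | m where "n = Suc (Suc m)"
    by (metis One_nat_def not0_implies_Suc)
  then show ?case
  proof cases
    case 1
    then show ?thesis by simp
  next
    case 2
    have "(l + u) * (x - 1) = (x - 1 - u) * l + u * (l + x - 1)"
      by (simp add: algebra_simps)
    then show ?thesis using 2 by simp
  next
    case 3
    have l2: "l ^ Suc (Suc m) = (l - u) * l ^ Suc m + l ^ m"
    proof -
      have "(l - u) * l ^ Suc m + l ^ m = l ^ m * (l * l - l * u + 1)"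
        by (simp add: algebra_simps)
      also have "\<dots> = l ^ Suc (Suc m)"
        using assms(1) by simp
      finally show ?thesis ..
    qed
    have u2: "(- u) ^ Suc (Suc m) = (l - u) * (- u) ^ Suc m + (- u) ^ m"
    proof -
      have "(l - u) * (- u) ^ Suc m + (- u) ^ m = (- u) ^ m * (u * u - l * u + 1)"
        by (simp add: algebra_simps)
      also have "\<dots> = (- u) ^ Suc (Suc m)"
        using assms(1) by simp
      finally show ?thesis ..
    qed
    have "(l + u) * poly (G k n) x
        = (l - u) * ((l + u) * poly (G k (Suc m)) x) + (l + u) * poly (G k m) x"
      unfolding 3 poly_G_Suc_Suc assms(2)[symmetric] by (simp only: algebra_simps)
    also have "\<dots> = (l - u) * ((x - 1 - u) * l ^ Suc m - (- u) ^ Suc m * (l + x - 1))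
        + ((x - 1 - u) * l ^ m - (- u) ^ m * (l + x - 1))"
      using less.IH[of "Suc m"] less.IH[of m] 3 by simp
    also have "\<dots> = (x - 1 - u) * ((l - u) * l ^ Suc m + l ^ m)
        - ((l - u) * (- u) ^ Suc m + (- u) ^ m) * (l + x - 1)"
      by (simp only: algebra_simps)
    finally show ?thesis
      unfolding l2[symmetric] u2[symmetric] 3[symmetric] .
  qed
qed

lemma poly_G_closed_form:
  fixes x :: real and k n :: nat
  assumes "x \<ge> 0"
  defines "l \<equiv> lam (x ^ k)"
  shows "(l + inverse l) * poly (G k n) x
    = (x - 1 - inverse l) * l ^ n - (- inverse l) ^ n * (l + x - 1)"
proof (rule poly_G_closed_form_aux)
  have t: "x ^ k \<ge> 0"
    using assms by simp
  show "l * inverse l = 1"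
    using lam_ge[OF t] t unfolding l_def by simp
  show "l - inverse l = x ^ k"
    unfolding l_def by (rule lam_minus_inverse[OF t])
qed

lemma poly_G_sgn_iff:
  fixes x :: real and k n :: nat
  assumes "x > 0"
  defines "l \<equiv> lam (x ^ k)"
  defines "r \<equiv> (x - 1 - inverse l) * l ^ n - (- inverse l) ^ n * (l + x - 1)"
  shows poly_G_pos_iff: "poly (G k n) x > 0 \<longleftrightarrow> r > 0"
    and poly_G_neg_iff: "poly (G k n) x < 0 \<longleftrightarrow> r < 0"
proof -
  have "l > 1"
    unfolding l_def using assms by (intro lam_gt_1) simp
  then have "l + inverse l > 0"
    by (intro add_pos_pos) auto
  moreover have "r = (l + inverse l) * poly (G k n) x"
    unfolding r_def l_def using poly_G_closed_form[of x k n] assms(1) by simp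
  ultimately show "poly (G k n) x > 0 \<longleftrightarrow> r > 0" "poly (G k n) x < 0 \<longleftrightarrow> r < 0"
    by (simp_all only: zero_less_mult_iff mult_less_0_iff) auto
qed

section \<open>The polynomial \<open>H\<close> and its root\<close>

lemma poly_H: "k \<ge> 1 \<Longrightarrow> poly (H k) x = x ^ (k - 1) * (x - 1) + x - 2"
  by (cases k) (auto simp: H_def poly_monom algebra_simps)

lemma poly_H_strict_mono:
  assumes "k \<ge> 1" "1 \<le> x" "x < y"
  shows "poly (H k) x < poly (H k) y"
proof -
  have "x ^ (k - 1) * (x - 1) \<le> y ^ (k - 1) * (y - 1)"
    using assms by (intro mult_mono power_mono) auto
  then show ?thesis
    using assms by (simp add: poly_H)
qed

lemma poly_H_neg:
  assumes "k \<ge> 1" "0 < x" "x \<le> 1"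
  shows "poly (H k) x < 0"
proof -
  have "x ^ (k - 1) * (x - 1) \<le> 0"
    using assms by (intro mult_nonneg_nonpos) auto
  then show ?thesis
    using assms by (simp add: poly_H)
qed

text \<open>The intermediate value theorem on [1, 2] gives existence. For uniqueness,
  \<open>poly_H_neg\<close> excludes roots in (0, 1] and strict monotonicity leaves at most one
  beyond 1.\<close>

lemma xi_root:
  assumes "k \<ge> 1"
  shows "1 < xi k" "xi k < 2" "poly (H k) (xi k) = 0"
proof -
  have "poly (H k) 1 < 0" "0 < poly (H k) 2"
    using assms by (simp_all add: poly_H)
  then obtain z where z: "1 < z" "z < 2" "poly (H k) z = 0"
    using poly_IVT_pos[of 1 2 "H k"] by auto
  have "x = z" if "x > 0 \<and> poly (H k) x = 0" for x
  proof -
    have "x > 1"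
      using poly_H_neg[of k x] assms that by force
    then show ?thesis
      using poly_H_strict_mono[of k x z] poly_H_strict_mono[of k z x] assms that z
      by (cases x z rule: linorder_cases) auto
  qed
  then have "xi k = z"
    unfolding xi_def using z by (intro the_equality) auto
  then show "1 < xi k" "xi k < 2" "poly (H k) (xi k) = 0"
    using z by auto
qed

lemma sgn_poly_H:
  assumes "k \<ge> 1" "1 \<le> x"
  shows "sgn (poly (H k) x) = sgn (x - xi k)"
proof (cases x "xi k" rule: linorder_cases)
  case less
  then have "poly (H k) x < 0"
    using poly_H_strict_mono[of k x "xi k"] xi_root(3)[of k] assms by simp
  then show ?thesis
    using less by simp
next
  case equal
  then show ?thesis
    using xi_root(3)[of k] assms by simp
next
  case greater
  then have "poly (H k) x > 0"
    using poly_H_strict_mono[of k "xi k" x] xi_root(1,3)[of k] assms by simp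
  then show ?thesis
    using greater by simp
qed

lemma sgn_lam_coefficient:
  assumes "k \<ge> 1" "1 < x"
  shows "sgn (x - 1 - inverse (lam (x ^ k))) = sgn (x - xi k)"
proof -
  define u where "u = inverse (lam (x ^ k))"
  have t: "x ^ k > 0"
    using assms by simp
  have u: "u > 0"
    using lam_gt_1[OF t] by (simp add: u_def)
  have "inverse u - u = x ^ k"
    using lam_minus_inverse[of "x ^ k"] t by (simp add: u_def)
  then have uu: "u * u = 1 - x ^ k * u"
    using u by (simp add: field_simps)
  have xk: "x * x ^ (k - 1) = x ^ k"
    using assms by (cases k) auto
  have "x * poly (H k) x = (x * x ^ (k - 1)) * (x - 1) + x * (x - 2)"
    using assms by (simp add: poly_H algebra_simps)
  \<comment> \<open>The product expands to
    \<open>x^k * (x - 1) + (x - 1)^2 - (x^k * u + u * u)\<close>, and \<open>uu\<close> turns the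
    last bracket into 1.\<close>
  also have "\<dots> = (x - 1 - u) * (x ^ k + (x - 1) + u)"
    unfolding xk using uu by (simp add: algebra_simps)
  finally have eq: "x * poly (H k) x = (x - 1 - u) * (x ^ k + (x - 1) + u)" .
  have "x ^ k + (x - 1) + u > 0"
    using t u assms by linarith
  then have "sgn (x - 1 - u) = sgn (poly (H k) x)"
    using arg_cong[OF eq, of sgn] assms by (simp add: sgn_mult)
  also have "\<dots> = sgn (x - xi k)"
    by (rule sgn_poly_H) (use assms in auto)
  finally show ?thesis
    unfolding u_def .
qed

section \<open>Locating the largest root by signs\<close>

lemma poly_G_ge_1:
  assumes "k \<ge> 1" "x \<ge> 2"
  shows "poly (G k (Suc n)) x \<ge> 1"
proof -
  have "x ^ 1 \<le> x ^ k"
    using assms by (intro power_increasing) auto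
  then have xk: "x ^ k \<ge> 2"
    using assms by simp
  have "poly (G k (Suc n)) x \<ge> 1 \<and> poly (G k (Suc (Suc n))) x \<ge> 1"
  proof (induction n)
    case 0
    \<comment> \<open>The factor 2 compensates for \<open>G k 0 = [:-1:]\<close>, which enters the
      recurrence for \<open>G k 2\<close>.\<close>
    have "2 * 1 \<le> x ^ k * (x - 1)"
      using xk assms by (intro mult_mono) auto
    then show ?case
      unfolding poly_G_Suc_Suc using assms by simp
  next
    case (Suc n)
    have "2 * 1 \<le> x ^ k * poly (G k (Suc (Suc n))) x"
      using xk Suc by (intro mult_mono) auto
    then have "poly (G k (Suc (Suc (Suc n)))) x \<ge> 1"
      using Suc unfolding poly_G_Suc_Suc[of k "Suc n"] by linarith
    then show ?case
      using Suc by blast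
  qed
  then show ?thesis ..
qed

lemma finite_roots_G:
  assumes "k \<ge> 1" "n \<ge> 1"
  shows "finite {x. poly (G k n) x = 0}"
proof (rule poly_roots_finite)
  show "G k n \<noteq> 0"
    using poly_G_ge_1[of k 2 "n - 1"] assms by auto
qed

text \<open>By \<open>poly_G_ge_1\<close> the polynomial is positive far to the right, so a negative
  value at \<open>x\<close> forces a root beyond \<open>x\<close>.\<close>

lemma less_g_if_poly_G_neg:
  assumes "k \<ge> 1" "n \<ge> 1" "poly (G k n) x < 0"
  shows "x < g k n"
proof -
  have "poly (G k n) (max x 2 + 1) \<ge> 1"
    using poly_G_ge_1[of k "max x 2 + 1" "n - 1"] assms by simp
  moreover have "x < max x 2 + 1"
    by simp
  ultimately obtain z where z: "x < z" "poly (G k n) z = 0"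
    using poly_IVT_pos[of x "max x 2 + 1" "G k n"] assms by auto
  then have "z \<le> g k n"
    unfolding g_def using finite_roots_G[OF assms(1,2)] by (intro Max_ge) auto
  then show ?thesis
    using z by simp
qed

lemma g_less_if_poly_G_pos:
  assumes "k \<ge> 1" "n \<ge> 1" "\<And>y. y \<ge> x \<Longrightarrow> poly (G k n) y > 0"
  shows "g k n < x"
proof -
  \<comment> \<open>Since \<open>k \<ge> 1\<close>, the factor \<open>monom 1 k\<close> vanishes at
    0 and the recurrence just repeats the value from two indices earlier. The resulting root between
    0 and 2 makes the set under \<open>Max\<close> nonempty.\<close>
  have "poly (G k n) 0 = -1"
    using assms(1)
    by (induction k n rule: G.induct) (simp_all add: poly_monom zero_power)
  then have "poly (G k n) 0 < 0" "poly (G k n) 2 > 0"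
    using poly_G_ge_1[of k 2 "n - 1"] assms(1,2) by auto
  then have "\<exists>z. poly (G k n) z = 0"
    using poly_IVT_pos[of 0 2 "G k n"] by auto
  then have "g k n \<in> {x. poly (G k n) x = 0}"
    unfolding g_def using finite_roots_G[OF assms(1,2)] by (intro Max_in) auto
  then show ?thesis
    using assms(3)[of "g k n"] by force
qed

section \<open>Parity\<close>

lemma xi_less_g_even:
  assumes "k \<ge> 1" "n \<ge> 1" "even n"
  shows "xi k < g k n"
proof (rule less_g_if_poly_G_neg)
  let ?l = "lam (xi k ^ k)"
  have xi: "xi k > 1"
    using xi_root assms by blast
  then have l: "?l > 1"
    by (intro lam_gt_1) simp
  have "xi k - 1 - inverse ?l = 0"
    using sgn_lam_coefficient[of k "xi k"] xi assms by (simp add: sgn_0_0)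
  moreover have "inverse ?l ^ n * (?l + xi k - 1) > 0"
    using l xi by (intro mult_pos_pos) auto
  ultimately show "poly (G k n) (xi k) < 0"
    using poly_G_neg_iff[of "xi k" k n] xi assms by simp
qed (use assms in auto)

text \<open>For odd \<open>n\<close> the term in \<open>(- u)^n\<close> contributes positively and
  the term in \<open>lam^n\<close> is nonnegative at every point from \<open>xi k\<close> on, so the
  whole half-line is free of roots.\<close>

lemma g_less_xi_odd:
  assumes "k \<ge> 1" "n \<ge> 1" "odd n"
  shows "g k n < xi k"
proof (rule g_less_if_poly_G_pos)
  fix y assume y: "y \<ge> xi k"
  let ?l = "lam (y ^ k)"
  have y1: "y > 1"
    using xi_root[of k] assms y by simp
  then have l: "?l > 1"
    by (intro lam_gt_1) simp
  have "y - 1 - inverse ?l \<ge> 0"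
    using sgn_lam_coefficient[of k y] y y1 assms by (auto simp: sgn_if split: if_splits)
  then have "(y - 1 - inverse ?l) * ?l ^ n \<ge> 0"
    using l by simp
  moreover have "inverse ?l ^ n * (?l + y - 1) > 0"
    using l y1 by (intro mult_pos_pos) auto
  ultimately show "poly (G k n) y > 0"
    using poly_G_pos_iff[of y k n] y1 assms by simp
qed (use assms in auto)

section \<open>Convergence of \<open>g k n\<close>\<close>

lemma eventually_power_gt:
  fixes a b :: real
  assumes "a > 1"
  shows "eventually (\<lambda>n. b < a ^ n) sequentially"
proof -
  obtain N where "b < a ^ N"
    using real_arch_pow[OF assms] by blast
  then have "b < a ^ n" if "n \<ge> N" for n
    by (rule less_le_trans) (use that assms in \<open>simp add: power_increasing\<close>)
  then show ?thesis
    unfolding eventually_sequentially by blast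
qed

lemma eventually_less_g:
  assumes "k \<ge> 1" "a < xi k"
  shows "eventually (\<lambda>n. a < g k n) sequentially"
proof -
  \<comment> \<open>\<open>a\<close> may lie below 1, while \<open>sgn_lam_coefficient\<close> needs
    a point greater than 1.\<close>
  have "max 1 a < xi k"
    using xi_root[of k] assms by simp
  then obtain x where x: "max 1 a < x" "x < xi k"
    using dense by blast
  then have x0: "x > 0"
    by simp
  let ?l = "lam (x ^ k)"
  let ?c = "inverse ?l - (x - 1)"
  have l: "?l > 1"
    using x by (intro lam_gt_1) simp
  have c: "?c > 0"
    using sgn_lam_coefficient[of k x] x assms by (auto simp: sgn_if split: if_splits)
  \<comment> \<open>Past this threshold \<open>?c * ?l ^ n\<close> exceeds
    \<open>?l + x - 1\<close>, which bounds the other term in absolute value.\<close>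
  have "eventually (\<lambda>n. (?l + x - 1) / ?c < ?l ^ n) sequentially"
    by (rule eventually_power_gt[OF l])
  then show ?thesis
    using eventually_ge_at_top[of 1]
  proof eventually_elim
    case (elim n)
    have big: "?l + x - 1 < ?c * ?l ^ n"
      using elim(1) c by (simp add: pos_divide_less_eq mult.commute)
    have "\<bar>(- inverse ?l) ^ n\<bar> \<le> 1"
      using l by (simp add: power_abs power_le_one inverse_le_1_iff)
    then have "- 1 \<le> (- inverse ?l) ^ n"
      by linarith
    then have low: "(- 1) * (?l + x - 1) \<le> (- inverse ?l) ^ n * (?l + x - 1)"
      by (rule mult_right_mono) (use l x in auto)
    have "(x - 1 - inverse ?l) * ?l ^ n = - (?c * ?l ^ n)"
      by (simp add: algebra_simps)
    also have "\<dots> < (- 1) * (?l + x - 1)"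
      using big by (simp only: mult_minus1 neg_less_iff_less)
    also note low
    finally have "poly (G k n) x < 0"
      unfolding poly_G_neg_iff[OF x0] less_iff_diff_less_0[symmetric] .
    then have "x < g k n"
      using less_g_if_poly_G_neg assms elim by blast
    then show ?case
      using x by simp
  qed
qed

text \<open>One \<open>n\<close> must serve all \<open>y \<ge> x\<close>, although the competing
  factor \<open>?l y + y - 1\<close> grows with \<open>y\<close>. It stays below
  \<open>2 * ?l y\<close>, so one factor \<open>?l y\<close> of the leading term absorbs it.\<close>

lemma eventually_g_less:
  assumes "k \<ge> 1" "xi k < x"
  shows "eventually (\<lambda>n. g k n < x) sequentially"
proof -
  have x: "x > 1"
    using xi_root[of k] assms by simp
  let ?l = "\<lambda>y. lam (y ^ k)"
  let ?c = "\<lambda>y. y - 1 - inverse (?l y)"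
  have l: "?l x > 1"
    using x by (intro lam_gt_1) simp
  have c: "?c x > 0"
    using sgn_lam_coefficient[of k x] x assms by (auto simp: sgn_if split: if_splits)
  have "eventually (\<lambda>n. 2 * ?l x / ?c x < ?l x ^ n) sequentially"
    by (rule eventually_power_gt[OF l])
  then show ?thesis
    using eventually_ge_at_top[of 1]
  proof eventually_elim
    case (elim n)
    show ?case
    proof (rule g_less_if_poly_G_pos[OF assms(1) elim(2)])
      fix y assume y: "y \<ge> x"
      then have y0: "y > 0"
        using x by simp
      obtain m where m: "n = Suc m"
        using elim(2) by (cases n) auto
      have "2 * ?l x < ?c x * ?l x ^ n"
        using elim(1) c by (simp add: pos_divide_less_eq mult.commute)
      \<comment> \<open>Cancelling one factor \<open>?l x\<close> leaves an inequality with constant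
        left side and a right side that increases with the point, so it passes from \<open>x\<close>
        to \<open>y\<close>.\<close>
      then have "2 * ?l x < (?c x * ?l x ^ m) * ?l x"
        by (simp add: m mult_ac)
      then have big: "2 < ?c x * ?l x ^ m"
        using l by (simp only: mult_less_cancel_right)
      have ll: "?l x \<le> ?l y"
        using x y by (intro lam_mono power_mono) auto
      then have "inverse (?l y) \<le> inverse (?l x)"
        using l by (intro le_imp_inverse_le) auto
      then have cc: "?c x \<le> ?c y"
        using y by linarith
      moreover have "?l x ^ m \<le> ?l y ^ m"
        using ll l by (intro power_mono) auto
      ultimately have "?c x * ?l x ^ m \<le> ?c y * ?l y ^ m"
        by (rule mult_mono) (use c l cc in linarith, use l in simp)
      then have "2 * ?l y < (?c y * ?l y ^ m) * ?l y"
        using big ll l by (intro mult_strict_right_mono) auto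
      then have A: "2 * ?l y < ?c y * ?l y ^ n"
        by (simp add: m mult_ac)
      \<comment> \<open>\<open>y \<le> y^k \<le> ?l y\<close> gives
        \<open>?l y + y - 1 < 2 * ?l y\<close>.\<close>
      have "y ^ 1 \<le> y ^ k"
        using x y assms by (intro power_increasing) auto
      then have yl: "y \<le> ?l y"
        using lam_ge_self[of "y ^ k"] x y by simp
      have "\<bar>(- inverse (?l y)) ^ n\<bar> \<le> 1"
        using l ll by (simp add: power_abs power_le_one inverse_le_1_iff)
      then have "(- inverse (?l y)) ^ n \<le> 1"
        by linarith
      then have "(- inverse (?l y)) ^ n * (?l y + y - 1) \<le> 1 * (?l y + y - 1)"
        by (rule mult_right_mono) (use l ll x y in auto)
      also have "\<dots> < 2 * ?l y"
        using yl by simp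
      also note A
      finally show "poly (G k n) y > 0"
        unfolding poly_G_pos_iff[OF y0] diff_gt_0_iff_gt .
    qed
  qed
qed

lemma g_tendsto_xi: "k \<ge> 1 \<Longrightarrow> (\<lambda>n. g k n) \<longlonglongrightarrow> xi k"
  by (rule order_tendstoI) (auto intro: eventually_less_g eventually_g_less)

section \<open>The limit of \<open>xi\<close>\<close>

text \<open>\<open>xi k > 1\<close> settles the lower side. For fixed \<open>a > 1\<close>, once
  \<open>a^(k-1) * (a - 1) > 1\<close> the value of \<open>H k\<close> at \<open>a\<close> exceeds
  \<open>a - 1 > 0\<close>, which puts \<open>xi k\<close> below \<open>a\<close>.\<close>

lemma xi_tendsto_1: "xi \<longlonglongrightarrow> 1"
proof (rule order_tendstoI)
  fix a :: real assume "a < 1"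
  then show "eventually (\<lambda>k. a < xi k) sequentially"
    by (intro eventually_mono[OF eventually_ge_at_top[of 1]]) (use xi_root in force)
next
  fix a :: real assume a: "1 < a"
  \<comment> \<open>The numerator \<open>a\<close> rather than 1 pays for the exponent
    \<open>k - 1\<close> in \<open>H\<close>.\<close>
  have "eventually (\<lambda>k. a / (a - 1) < a ^ k) sequentially"
    by (rule eventually_power_gt[OF a])
  then show "eventually (\<lambda>k. xi k < a) sequentially"
    using eventually_ge_at_top[of 1]
  proof eventually_elim
    case (elim k)
    obtain m where m: "k = Suc m"
      using elim(2) by (cases k) auto
    have "a * 1 < a * (a ^ m * (a - 1))"
      using elim(1) a by (simp add: m pos_divide_less_eq mult.assoc)
    then have "1 < a ^ m * (a - 1)"
      using a by (simp only: mult_less_cancel_left)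
    then have "poly (H k) a > 0"
      using a elim(2) by (simp add: poly_H m)
    then have "sgn (a - xi k) = 1"
      using sgn_poly_H[of k a] a elim(2) by simp
    then show ?case
      by (simp add: sgn_1_pos)
  qed
qed

theorem mainTheorem1:
  shows "(\<forall>k\<ge>1. (\<lambda>n. g k n) \<longlonglongrightarrow> xi k
            \<and> (\<forall>n\<ge>1. even n \<longrightarrow> g k n > xi k)
            \<and> (\<forall>n\<ge>1. odd n \<longrightarrow> g k n < xi k))
       \<and> (\<lambda>k. xi k) \<longlonglongrightarrow> 1"
  by (intro conjI allI impI g_tendsto_xi xi_less_g_even g_less_xi_odd xi_tendsto_1)

end
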